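(* Let $C$ be a nonempty compact convex subset of a uniformly convex Banach space $X$, and let $T:C\to C$ be a mapping satisfying condition $(C)$. For arbitrarily chosen $x_0\in C$, let the sequence $\{x_n\}$ be generated by $$z_n=(1-\beta_n)x_n+\beta_nTx_n,\qquad y_n=T\big((1-\alpha_n)Tx_n+\alpha_nTz_n\big),\qquad x_{n+1}=Ty_n\qquad(n\ge 0),$$ where $\{\alpha_n\}$ and $\{\beta_n\}$ are sequences of real numbers in $[a,b]$ for some $a,b$ with $0<a\le b<1$. Then $\{x_n\}$ converges strongly (in norm) to a fixed point of $T$.
   Context: A mapping $T:C\to C$ satisfies condition $(C)$ (is Suzuki generalized nonexpansive) if for all $x,y\in C$, $\frac12\|x-Tx\|\le\|x-y\|$ implies $\|Tx-Ty\|\le\|x-y\|$. Uniform convexity of a Banach space is understood in the standard sense. *)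

theory Defs
  imports "HOL-Analysis.Analysis"
begin

(* Uniform convexity is a property of the whole normed space, i.e. of the type 'a;
   the standard epsilon-delta definition on the closed unit ball. *)
definition uniformly_convex_space :: "'a::real_normed_vector itself \<Rightarrow> bool" where
  "uniformly_convex_space (_ :: 'a itself) \<longleftrightarrow>
     (\<forall>\<epsilon>::real. 0 < \<epsilon> \<and> \<epsilon> \<le> 2 \<longrightarrow>
        (\<exists>\<delta>>0. \<forall>x y :: 'a. norm x \<le> 1 \<and> norm y \<le> 1 \<and> norm (x - y) \<ge> \<epsilon> \<longrightarrow>
           norm ((1/2) *\<^sub>R (x + y)) \<le> 1 - \<delta>))"

definition condition_C :: "'a::real_normed_vector set \<Rightarrow> ('a \<Rightarrow> 'a) \<Rightarrow> bool" where
  "condition_C C T \<longleftrightarrow>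
     (\<forall>x\<in>C. \<forall>y\<in>C. (1/2) * norm (x - T x) \<le> norm (x - y) \<longrightarrow>
        norm (T x - T y) \<le> norm (x - y))"

end

theory Submission
  imports Defs
begin

text \<open>
  Under condition (C), an approximate fixed point sequence in a compact set has a subsequence that
  converges to a genuine fixed point, although \<open>T\<close> need not be continuous.  The reason is
  Suzuki's inequality \<open>condition_C_displacement\<close>, which replaces continuity; the compactness
  argument is \<open>approximate_fixed_points_subsequence\<close>.  So everything rests on producing
  approximate fixed points, and both times this is done by uniform convexity: two vectors of norm at
  most \<open>R\<close> must be close to each other if some convex combination of them, with weights bounded
  away from \<open>0\<close> and \<open>1\<close>, has norm close to \<open>R\<close>
  (\<open>uniformly_convex_midpoint\<close>, \<open>uniformly_convex_combination\<close>).

  First, a fixed point \<open>p\<close> exists.  Consider \<open>u\<^sub>n\<^sub>+\<^sub>1 = (u\<^sub>n + T u\<^sub>n) / 2\<close>,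
  for which the displacements \<open>d\<^sub>n = T u\<^sub>n - u\<^sub>n\<close> have nonincreasing norm.  If the norms did not
  tend to zero, uniform convexity would force \<open>d\<^sub>n\<^sub>+\<^sub>1 - d\<^sub>n\<close> to zero, so the iterates would
  march in an almost constant direction with steps bounded below, and leave every bounded set.

  Second, every fixed point \<open>p\<close> satisfies \<open>norm (T v - p) \<le> norm (v - p)\<close>, so the
  distances \<open>norm (x\<^sub>n - p)\<close> decrease to a limit \<open>r\<close>.  As \<open>\<alpha>\<^sub>n\<close> is bounded away from
  zero, \<open>norm (z\<^sub>n - p)\<close> has the same limit.  But \<open>z\<^sub>n - p\<close> is a convex combination of
  \<open>x\<^sub>n - p\<close> and \<open>T x\<^sub>n - p\<close>, whence \<open>x\<^sub>n - T x\<^sub>n\<close> tends to zero.  A subsequence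
  of \<open>x\<^sub>n\<close> then converges to a fixed point \<open>q\<close>, and since \<open>norm (x\<^sub>n - q)\<close> is monotone,
  the whole sequence converges to \<open>q\<close>.
\<close>

section \<open>Uniform convexity along sequences\<close>

text \<open>The definition only speaks of the closed unit ball; this is its rescaling to balls of
  variable radius.  If the limit radius is zero the claim is trivial, and otherwise the radii
  eventually lie between two positive constants, so that a single modulus serves for all of them.\<close>

lemma uniformly_convex_midpoint:
  fixes p q :: "nat \<Rightarrow> 'a::real_normed_vector"
  assumes uc: "uniformly_convex_space TYPE('a)"
    and p: "\<And>n. norm (p n) \<le> R n" and q: "\<And>n. norm (q n) \<le> R n"
    and R: "R \<longlonglongrightarrow> r"
    and mid: "(\<lambda>n. norm ((1/2) *\<^sub>R (p n + q n))) \<longlonglongrightarrow> r"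
  shows "(\<lambda>n. p n - q n) \<longlonglongrightarrow> 0"
proof -
  have R0: "0 \<le> R n" for n
    using p[of n] norm_ge_zero order_trans by blast
  then have "0 \<le> r"
    using R by (intro LIMSEQ_le_const[of R]) auto
  show ?thesis
  proof (cases "r = 0")
    case True
    have "norm (p n - q n) \<le> 2 * R n" for n
      using norm_triangle_ineq4[of "p n" "q n"] p[of n] q[of n] by linarith
    moreover have "(\<lambda>n. 2 * R n) \<longlonglongrightarrow> 0"
      using tendsto_mult_left[OF R, of 2] True by simp
    ultimately show ?thesis
      by (rule Lim_null_comparison[OF always_eventually[OF allI]])
  next
    case False
    with \<open>0 \<le> r\<close> have "0 < r" by simp
    show ?thesis
    proof (rule LIMSEQ_I)
      fix e :: real assume "0 < e"
      \<comment> \<open>Eventually \<open>R n < 2 r\<close>, so a distance of at least \<open>e\<close> is at least \<open>\<epsilon>\<close> after division by \<open>R n\<close>;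
        the minimum keeps \<open>\<epsilon>\<close> in the range of the definition.\<close>
      define \<epsilon> where "\<epsilon> = min 2 (e / (2 * r))"
      have "0 < \<epsilon>" "\<epsilon> \<le> 2" and "\<epsilon> \<le> e / (2 * r)"
        using \<open>0 < e\<close> \<open>0 < r\<close> by (simp_all add: \<epsilon>_def)
      then have "\<epsilon> * (2 * r) \<le> e"
        using \<open>0 < r\<close> by (simp add: pos_le_divide_eq)
      have "\<exists>\<delta>>0. \<forall>x y :: 'a. norm x \<le> 1 \<and> norm y \<le> 1 \<and> \<epsilon> \<le> norm (x - y) \<longrightarrow>
          norm ((1/2) *\<^sub>R (x + y)) \<le> 1 - \<delta>"
        by (rule uc[unfolded uniformly_convex_space_def, THEN spec, THEN mp])
           (rule conjI[OF \<open>0 < \<epsilon>\<close> \<open>\<epsilon> \<le> 2\<close>])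
      then obtain \<delta> where "0 < \<delta>" and \<delta>: "\<forall>x y :: 'a. norm x \<le> 1 \<and> norm y \<le> 1 \<and>
          \<epsilon> \<le> norm (x - y) \<longrightarrow> norm ((1/2) *\<^sub>R (x + y)) \<le> 1 - \<delta>"
        by (elim exE conjE)
      have "\<forall>\<^sub>F n in sequentially. R n < 2 * r"
        using order_tendstoD(2)[OF R, of "2 * r"] \<open>0 < r\<close> by simp
      moreover have "\<forall>\<^sub>F n in sequentially. 0 < R n"
        using order_tendstoD(1)[OF R \<open>0 < r\<close>] .
      moreover have "\<forall>\<^sub>F n in sequentially. 0 < norm ((1/2) *\<^sub>R (p n + q n)) - (1 - \<delta>) * R n"
      proof (rule order_tendstoD(1))
        show "(\<lambda>n. norm ((1/2) *\<^sub>R (p n + q n)) - (1 - \<delta>) * R n) \<longlonglongrightarrow> r - (1 - \<delta>) * r"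
          by (intro tendsto_intros mid R)
        show "0 < r - (1 - \<delta>) * r"
          using \<open>0 < r\<close> \<open>0 < \<delta>\<close> by (simp add: algebra_simps)
      qed
      ultimately have "\<forall>\<^sub>F n in sequentially. norm (p n - q n) < e"
      proof eventually_elim
        case (elim n)
        then have Rn: "0 < R n" by simp
        let ?x = "p n /\<^sub>R R n" and ?y = "q n /\<^sub>R R n"
        show ?case
        proof (rule ccontr)
          assume "\<not> norm (p n - q n) < e"
          moreover have "\<epsilon> * R n \<le> \<epsilon> * (2 * r)"
            using elim \<open>0 < \<epsilon>\<close> by (intro mult_left_mono) auto
          ultimately have far: "\<epsilon> * R n \<le> norm (p n - q n)"
            using \<open>\<epsilon> * (2 * r) \<le> e\<close> by linarith
          have "norm (?x - ?y) = norm (p n - q n) / R n"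
            using Rn by (simp only: scaleR_diff_right[symmetric] norm_scaleR abs_inverse abs_of_pos
                divide_inverse mult.commute)
          then have "\<epsilon> \<le> norm (?x - ?y)"
            using far Rn by (simp only: pos_le_divide_eq)
          moreover have "norm ?x \<le> 1" "norm ?y \<le> 1"
            using p[of n] q[of n] Rn by (simp_all add: inverse_eq_divide)
          ultimately have "norm ((1/2) *\<^sub>R (?x + ?y)) \<le> 1 - \<delta>"
            by (intro \<delta>[rule_format] conjI)
          moreover have "norm ((1/2) *\<^sub>R (?x + ?y)) = norm ((1/2) *\<^sub>R (p n + q n)) / R n"
          proof -
            have "(1/2) *\<^sub>R (?x + ?y) = inverse (R n) *\<^sub>R ((1/2) *\<^sub>R (p n + q n))"
              by (simp only: scaleR_add_right[symmetric] scaleR_scaleR mult.commute)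
            then show ?thesis
              using Rn by (simp only: norm_scaleR[of "inverse (R n)"] abs_inverse abs_of_pos
                  divide_inverse mult.commute)
          qed
          ultimately have "norm ((1/2) *\<^sub>R (p n + q n)) \<le> (1 - \<delta>) * R n"
            using Rn by (simp only: pos_divide_le_eq)
          then show False
            using elim by linarith
        qed
      qed
      then show "\<exists>n0. \<forall>n\<ge>n0. norm (p n - q n - 0) < e"
        by (simp add: eventually_sequentially)
    qed
  qed
qed

text \<open>With \<open>m = (u + v) / 2\<close>, the combination \<open>(1 - t) u + t v\<close> lies between \<open>m\<close> and whichever of
  \<open>u\<close>, \<open>v\<close> has the larger weight.  So a defect \<open>R - norm m\<close> at the midpoint reappears at the
  combination, reduced at most by the factor \<open>2 min t (1 - t)\<close>.\<close>

lemma norm_midpoint_defect: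
  fixes u v :: "'a::real_normed_vector"
  assumes "norm u \<le> R" "norm v \<le> R" "0 \<le> t" "t \<le> 1" "c \<le> t" "c \<le> 1 - t"
  shows "2 * c * (R - norm ((1/2) *\<^sub>R (u + v))) \<le> R - norm ((1 - t) *\<^sub>R u + t *\<^sub>R v)"
proof -
  let ?m = "(1/2) *\<^sub>R (u + v)"
  have "norm ?m \<le> R"
    using norm_triangle_ineq[of u v] assms(1,2) by simp
  have *: "2 * s * (R - norm ?m) \<le> R - norm ((1 - s) *\<^sub>R w + s *\<^sub>R w')"
    if "norm w \<le> R" "w + w' = u + v" "0 \<le> s" "s \<le> 1/2" for s w w'
  proof -
    have w': "w' = u + v - w"
      using that(2) by (simp add: algebra_simps)
    have "(1 - s) *\<^sub>R w + s *\<^sub>R w' = (1 - 2 * s) *\<^sub>R w + (2 * s) *\<^sub>R ?m"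
      using scaleR_add_left[of s s w] unfolding w' by (simp add: algebra_simps)
    then have "norm ((1 - s) *\<^sub>R w + s *\<^sub>R w') \<le> (1 - 2 * s) * norm w + 2 * s * norm ?m"
      using norm_triangle_ineq[of "(1 - 2 * s) *\<^sub>R w" "(2 * s) *\<^sub>R ?m"] that(3,4) by simp
    also have "\<dots> \<le> (1 - 2 * s) * R + 2 * s * norm ?m"
      using that by (intro add_right_mono mult_left_mono) auto
    finally show ?thesis by (simp add: algebra_simps)
  qed
  show ?thesis
  proof (cases "t \<le> 1/2")
    case True
    have "2 * c * (R - norm ?m) \<le> 2 * t * (R - norm ?m)"
      using \<open>norm ?m \<le> R\<close> assms by (intro mult_right_mono) auto
    then show ?thesis
      using *[of u v t] True assms by simp
  next
    case False
    have "2 * c * (R - norm ?m) \<le> 2 * (1 - t) * (R - norm ?m)"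
      using \<open>norm ?m \<le> R\<close> assms by (intro mult_right_mono) auto
    then show ?thesis
      using *[of v u "1 - t"] False assms by (simp add: add.commute)
  qed
qed

text \<open>A lemma of Schu: the midpoint may be replaced by varying convex combinations, as long as the
  weights stay away from \<open>0\<close> and \<open>1\<close>.\<close>

lemma uniformly_convex_combination:
  fixes p q :: "nat \<Rightarrow> 'a::real_normed_vector"
  assumes uc: "uniformly_convex_space TYPE('a)"
    and t: "\<And>n. t n \<in> {a..b}" and ab: "0 < a" "b < 1"
    and p: "\<And>n. norm (p n) \<le> R n" and q: "\<And>n. norm (q n) \<le> R n"
    and R: "R \<longlonglongrightarrow> r"
    and comb: "(\<lambda>n. norm ((1 - t n) *\<^sub>R p n + t n *\<^sub>R q n)) \<longlonglongrightarrow> r"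
  shows "(\<lambda>n. p n - q n) \<longlonglongrightarrow> 0"
proof -
  let ?m = "\<lambda>n. norm ((1/2) *\<^sub>R (p n + q n))"
  let ?g = "\<lambda>n. R n - norm ((1 - t n) *\<^sub>R p n + t n *\<^sub>R q n)"
  define c where "c = min a (1 - b)"
  have "0 < c" using ab by (simp add: c_def)
  have "(\<lambda>n. R n - ?m n) \<longlonglongrightarrow> 0"
  proof (rule Lim_null_comparison)
    have "(\<lambda>n. ?g n / (2 * c)) \<longlonglongrightarrow> (r - r) / (2 * c)"
      using \<open>0 < c\<close> by (intro tendsto_intros R comb) simp
    then show "(\<lambda>n. ?g n / (2 * c)) \<longlonglongrightarrow> 0" by simp
    have "norm (R n - ?m n) \<le> ?g n / (2 * c)" for n
    proof -
      have "?m n \<le> R n"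
        using norm_triangle_ineq[of "p n" "q n"] p[of n] q[of n] by simp
      moreover have "2 * c * (R n - ?m n) \<le> ?g n"
        using t[of n] ab p[of n] q[of n] by (intro norm_midpoint_defect) (auto simp: c_def)
      ultimately show ?thesis
        using \<open>0 < c\<close> by (simp add: field_simps)
    qed
    then show "\<forall>\<^sub>F n in sequentially. norm (R n - ?m n) \<le> ?g n / (2 * c)" by simp
  qed
  from tendsto_diff[OF R this] have "?m \<longlonglongrightarrow> r" by simp
  with uniformly_convex_midpoint[OF uc p q R] show ?thesis by blast
qed

section \<open>Condition (C) and approximate fixed points\<close>

text \<open>Suzuki's inequality, in which no comparison between \<open>norm (x - T x)\<close> and \<open>norm (x - y)\<close> is
  assumed.  The points \<open>x\<close> and \<open>T x\<close> cannot both be too close to \<open>y\<close>, because \<open>T x\<close> is displaced no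
  more than \<open>x\<close>.  So condition (C) applies to \<open>x, y\<close> or to \<open>T x, y\<close>.\<close>

lemma condition_C_displacement:
  assumes C: "condition_C C T" "T \<in> C \<rightarrow> C" and "x \<in> C" "y \<in> C"
  shows "norm (x - T y) \<le> 3 * norm (T x - x) + norm (x - y)"
proof -
  have Tx: "T x \<in> C" using assms by auto
  have cond: "norm (T u - T v) \<le> norm (u - v)"
    if "u \<in> C" "v \<in> C" "(1/2) * norm (u - T u) \<le> norm (u - v)" for u v
    using C(1) that unfolding condition_C_def by blast
  have step: "norm (T x - T (T x)) \<le> norm (x - T x)"
    by (rule cond) (use assms Tx in auto)
  have sym: "norm (T x - x) = norm (x - T x)" "norm (T x - y) = norm (y - T x)"
    by (simp_all add: norm_minus_commute)
  have tri: "norm (u - v) \<le> norm (u - w) + norm (w - v)" for u v w :: 'a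
    using norm_triangle_ineq[of "u - w" "w - v"] by simp
  consider "(1/2) * norm (x - T x) \<le> norm (x - y)"
    | "(1/2) * norm (T x - T (T x)) \<le> norm (T x - y)"
    using tri[of x "T x" y] step sym by linarith
  then show ?thesis
  proof cases
    case 1
    then have "norm (T x - T y) \<le> norm (x - y)"
      using cond assms by blast
    then show ?thesis
      using tri[of x "T y" "T x"] sym norm_ge_zero[of "x - T x"] by linarith
  next
    case 2
    then have "norm (T (T x) - T y) \<le> norm (T x - y)"
      using cond assms Tx by blast
    then show ?thesis
      using tri[of x "T y" "T x"] tri[of "T x" "T y" "T (T x)"] tri[of "T x" y x] step sym
      by linarith
  qed
qed

lemma condition_C_fixed_point:
  assumes "condition_C C T" "p \<in> C" "T p = p" "v \<in> C"
  shows "norm (T v - p) \<le> norm (v - p)"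
proof -
  have "(1/2) * norm (p - T p) \<le> norm (p - v)"
    using assms(3) by simp
  then have "norm (T p - T v) \<le> norm (p - v)"
    using assms unfolding condition_C_def by blast
  then show ?thesis
    using assms(3) by (simp add: norm_minus_commute)
qed

text \<open>Along a convergent approximate fixed point sequence, Suzuki's inequality makes the sequence
  converge also to the image of its limit.\<close>

lemma approximate_fixed_points_subsequence:
  fixes u :: "nat \<Rightarrow> 'a::real_normed_vector"
  assumes "compact C" and C: "condition_C C T" "T \<in> C \<rightarrow> C"
    and u: "\<And>n. u n \<in> C" and lim: "(\<lambda>n. T (u n) - u n) \<longlonglongrightarrow> 0"
  obtains q s where "q \<in> C" "T q = q" "strict_mono (s :: nat \<Rightarrow> nat)" "(u \<circ> s) \<longlonglongrightarrow> q"
proof -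
  obtain q s where q: "q \<in> C" and s: "strict_mono (s :: nat \<Rightarrow> nat)" and us: "(u \<circ> s) \<longlonglongrightarrow> q"
    using \<open>compact C\<close> u unfolding compact_def by metis
  let ?b = "\<lambda>n. 3 * norm (T (u (s n)) - u (s n)) + norm (u (s n) - q)"
  have "(\<lambda>n. T (u (s n)) - u (s n)) \<longlonglongrightarrow> 0"
    using LIMSEQ_subseq_LIMSEQ[OF lim s] by (simp add: o_def)
  moreover have us': "(\<lambda>n. u (s n)) \<longlonglongrightarrow> q"
    using us by (simp add: o_def)
  ultimately have "?b \<longlonglongrightarrow> 3 * norm (0 :: 'a) + norm (q - q)"
    by (intro tendsto_intros)
  then have "?b \<longlonglongrightarrow> 0" by simp
  then have "(\<lambda>n. u (s n) - T q) \<longlonglongrightarrow> 0"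
    by (rule Lim_null_comparison[rotated])
       (use condition_C_displacement[OF C u q] in simp)
  then have "(\<lambda>n. u (s n)) \<longlonglongrightarrow> T q"
    by (rule LIM_zero_cancel)
  with us' have "T q = q"
    using LIMSEQ_unique by blast
  with q s us show thesis using that by blast
qed

section \<open>Existence of a fixed point\<close>

text \<open>Existence of a fixed point, by the averaged iteration described at the top.  No fixed point is
  available yet as a centre, so uniform convexity is applied to the displacements themselves:
  \<open>d\<^sub>n\<^sub>+\<^sub>1\<close> is the sum of \<open>d\<^sub>n / 2\<close> and \<open>T u\<^sub>n\<^sub>+\<^sub>1 - T u\<^sub>n\<close>, both of norm at most
  \<open>norm d\<^sub>n / 2\<close>.\<close>

lemma condition_C_has_fixed_point:
  fixes C :: "'a::real_normed_vector set"
  assumes uc: "uniformly_convex_space TYPE('a)"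
    and "C \<noteq> {}" "compact C" "convex C" and C: "condition_C C T" "T \<in> C \<rightarrow> C"
  obtains p where "p \<in> C" "T p = p"
proof -
  obtain u0 where "u0 \<in> C" using \<open>C \<noteq> {}\<close> by blast
  define u where "u n = ((\<lambda>v. (1/2) *\<^sub>R (v + T v)) ^^ n) u0" for n
  define d where "d n = T (u n) - u n" for n
  have u_Suc: "u (Suc n) = (1/2) *\<^sub>R (u n + T (u n))" for n
    by (simp add: u_def)
  have u: "u n \<in> C" for n
  proof (induction n)
    case (Suc n)
    then have "T (u n) \<in> C" using C by auto
    then have "(1/2) *\<^sub>R u n + (1/2) *\<^sub>R T (u n) \<in> C"
      using Suc convexD[OF \<open>convex C\<close>] by simp
    then show ?case by (simp add: u_Suc scaleR_add_right)
  qed (use \<open>u0 \<in> C\<close> in \<open>simp add: u_def\<close>)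
  have u_step: "u (Suc n) - u n = (1/2) *\<^sub>R d n" for n
  proof -
    have "u n = (1/2) *\<^sub>R u n + (1/2) *\<^sub>R u n"
      by (simp flip: scaleR_add_left)
    then show ?thesis
      unfolding u_Suc d_def by (simp add: algebra_simps)
  qed
  define e where "e n = T (u (Suc n)) - T (u n)" for n
  have e_le: "norm (e n) \<le> norm (d n) / 2" for n
  proof -
    have "norm (u n - u (Suc n)) = norm (d n) / 2"
      using u_step[of n] by (simp add: norm_minus_commute[of "u n"])
    moreover from this have "norm (T (u n) - T (u (Suc n))) \<le> norm (u n - u (Suc n))"
      using C(1) u unfolding condition_C_def
      by (simp add: d_def norm_minus_commute[of "u n" "T (u n)"])
    ultimately show ?thesis
      by (simp add: e_def norm_minus_commute)
  qed
  have d_Suc: "d (Suc n) = (1/2) *\<^sub>R d n + e n" for n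
  proof -
    have "d (Suc n) = d n - (u (Suc n) - u n) + e n"
      by (simp add: d_def e_def)
    also have "d n - (u (Suc n) - u n) = (1/2) *\<^sub>R d n"
      unfolding u_step using scaleR_left_diff_distrib[of 1 "1/2" "d n"] by simp
    finally show ?thesis .
  qed
  have "norm (d (Suc n)) \<le> norm (d n)" for n
    using norm_triangle_ineq[of "(1/2) *\<^sub>R d n" "e n"] e_le[of n] by (simp add: d_Suc)
  then have "decseq (\<lambda>n. norm (d n))"
    by (rule decseq_SucI)
  then obtain r where r: "(\<lambda>n. norm (d n)) \<longlonglongrightarrow> r" and r_le: "\<And>n. r \<le> norm (d n)"
    using decseq_convergent[of "\<lambda>n. norm (d n)" 0] by auto
  have d_diff: "(\<lambda>n. d (Suc n) - d n) \<longlonglongrightarrow> 0"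
  proof -
    have "(\<lambda>n. (1/2) *\<^sub>R d n - e n) \<longlonglongrightarrow> 0"
    proof (rule uniformly_convex_midpoint[OF uc])
      show "(\<lambda>n. norm (d n) / 2) \<longlonglongrightarrow> r / 2"
        by (intro tendsto_intros r) simp
      have "(\<lambda>n. norm (d (Suc n)) / 2) \<longlonglongrightarrow> r / 2"
        by (intro tendsto_intros LIMSEQ_Suc r) simp
      then show "(\<lambda>n. norm ((1/2) *\<^sub>R ((1/2) *\<^sub>R d n + e n))) \<longlonglongrightarrow> r / 2"
        by (simp flip: d_Suc)
    qed (use e_le in auto)
    from tendsto_minus[OF this] have "(\<lambda>n. - ((1/2) *\<^sub>R d n - e n)) \<longlonglongrightarrow> 0"
      by simp
    moreover have "- ((1/2) *\<^sub>R d n - e n) = d (Suc n) - d n" for n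
      using scaleR_left_diff_distrib[of "1/2" 1 "d n"] unfolding d_Suc by (simp add: algebra_simps)
    ultimately show ?thesis by simp
  qed
  have d_diffs: "(\<lambda>n. d (n + k) - d n) \<longlonglongrightarrow> 0" for k
  proof (induction k)
    case (Suc k)
    from tendsto_add[OF LIMSEQ_ignore_initial_segment[OF d_diff, of k] Suc]
    show ?case by simp
  qed simp
  \<comment> \<open>For each fixed number \<open>k\<close> of steps, the path starting at a late \<open>u n\<close> is nearly straight.\<close>
  have march: "(\<lambda>n. u (n + k) - u n - (real k / 2) *\<^sub>R d n) \<longlonglongrightarrow> 0" for k
  proof (induction k)
    case (Suc k)
    have "(\<lambda>n. (u (n + k) - u n - (real k / 2) *\<^sub>R d n) + (1/2) *\<^sub>R (d (n + k) - d n))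
        \<longlonglongrightarrow> 0 + (1/2) *\<^sub>R 0"
      by (intro tendsto_intros Suc d_diffs)
    moreover have "(u (n + k) - u n - (real k / 2) *\<^sub>R d n) + (1/2) *\<^sub>R (d (n + k) - d n)
        = u (n + Suc k) - u n - (real (Suc k) / 2) *\<^sub>R d n" for n
    proof -
      have "u (n + Suc k) = u (n + k) + (1/2) *\<^sub>R d (n + k)"
        using u_step[of "n + k"] by (simp add: algebra_simps)
      then show ?thesis
        by (simp add: algebra_simps add_divide_distrib)
    qed
    ultimately show ?case by simp
  qed simp
  have "r = 0"
  proof (rule ccontr)
    assume "r \<noteq> 0"
    moreover have "0 \<le> r"
      using r by (intro LIMSEQ_le_const[of "\<lambda>n. norm (d n)"]) auto
    ultimately have "0 < r" by simp
    obtain B where B: "\<And>v. v \<in> C \<Longrightarrow> norm v \<le> B"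
      using compact_imp_bounded[OF \<open>compact C\<close>] unfolding bounded_iff by blast
    \<comment> \<open>A straight path of \<open>k\<close> half-steps has length at least \<open>k r / 2\<close>, which is to exceed the
      diameter bound \<open>2 B\<close> by more than the error \<open>1\<close> allowed below.\<close>
    obtain k :: nat where k: "(2 * B + 1) * 2 / r < real k"
      using reals_Archimedean2 by blast
    have "\<forall>\<^sub>F n in sequentially. norm (u (n + k) - u n - (real k / 2) *\<^sub>R d n) < 1"
      using tendstoD[OF march[of k], of 1] by (simp add: dist_norm)
    then obtain n where n: "norm (u (n + k) - u n - (real k / 2) *\<^sub>R d n) < 1"
      using eventually_happens[of _ sequentially] by auto
    have "2 * B + 1 < real k / 2 * r"
      using k \<open>0 < r\<close> by (simp add: field_simps)
    also have "\<dots> \<le> real k / 2 * norm (d n)"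
      by (intro mult_left_mono r_le) simp
    also have "\<dots> = norm ((real k / 2) *\<^sub>R d n)"
      by simp
    also have "\<dots> \<le> norm (u (n + k) - u n) + norm (u (n + k) - u n - (real k / 2) *\<^sub>R d n)"
      by (metis norm_triangle_sub norm_minus_commute)
    also have "\<dots> < 2 * B + 1"
      using n norm_triangle_ineq4[of "u (n + k)" "u n"] B[OF u, of n] B[OF u, of "n + k"] by linarith
    finally show False .
  qed
  with r have "(\<lambda>n. T (u n) - u n) \<longlonglongrightarrow> 0"
    by (simp add: d_def tendsto_norm_zero_iff)
  from approximate_fixed_points_subsequence[OF \<open>compact C\<close> C u this] that
  show thesis by blast
qed

section \<open>Convergence of the iteration\<close>

theorem theorem4p4:
  fixes C :: "'a::banach set" and T :: "'a \<Rightarrow> 'a"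
    and x y z :: "nat \<Rightarrow> 'a" and \<alpha> \<beta> :: "nat \<Rightarrow> real" and a b :: real
  assumes "uniformly_convex_space TYPE('a)"
    and "C \<noteq> {}" and "compact C" and "convex C"
    and "T \<in> C \<rightarrow> C" and "condition_C C T"
    and "0 < a" and "a \<le> b" and "b < 1"
    and "\<And>n. \<alpha> n \<in> {a..b}" and "\<And>n. \<beta> n \<in> {a..b}"
    and "x 0 \<in> C"
    and "\<And>n. z n = (1 - \<beta> n) *\<^sub>R x n + \<beta> n *\<^sub>R T (x n)"
    and "\<And>n. y n = T ((1 - \<alpha> n) *\<^sub>R T (x n) + \<alpha> n *\<^sub>R T (z n))"
    and "\<And>n. x (Suc n) = T (y n)"
  shows "\<exists>p\<in>C. T p = p \<and> x \<longlonglongrightarrow> p"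
proof -
  note C = \<open>condition_C C T\<close> \<open>T \<in> C \<rightarrow> C\<close>
  note z = assms(13) and y = assms(14) and x_Suc = assms(15)
  define w where "w n = (1 - \<alpha> n) *\<^sub>R T (x n) + \<alpha> n *\<^sub>R T (z n)" for n
  have TC: "v \<in> C \<Longrightarrow> T v \<in> C" for v using C(2) by auto
  have \<alpha>: "a \<le> \<alpha> n" "0 \<le> \<alpha> n" "\<alpha> n \<le> 1" and \<beta>: "0 \<le> \<beta> n" "\<beta> n \<le> 1" for n
    using assms(10)[of n] assms(11)[of n] \<open>0 < a\<close> \<open>b < 1\<close> by auto
  have zC_if: "z n \<in> C" and wC_if: "w n \<in> C" if "x n \<in> C" for n
  proof -
    show "z n \<in> C"
      unfolding z using that TC \<beta> by (intro convexD[OF \<open>convex C\<close>]) auto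
    then show "w n \<in> C"
      unfolding w_def using that TC \<alpha> by (intro convexD[OF \<open>convex C\<close>]) auto
  qed
  have xC: "x n \<in> C" for n
  proof (induction n)
    case (Suc n)
    then show ?case
      unfolding x_Suc y using wC_if TC w_def by simp
  qed (fact \<open>x 0 \<in> C\<close>)
  note zC = zC_if[OF xC] and wC = wC_if[OF xC]

  have comb: "norm ((1 - t) *\<^sub>R v + t *\<^sub>R v' - p) \<le> (1 - t) * norm (v - p) + t * norm (v' - p)"
    if "0 \<le> t" "t \<le> 1" for t and v v' p :: 'a
  proof -
    have "(1 - t) *\<^sub>R v + t *\<^sub>R v' - p = (1 - t) *\<^sub>R (v - p) + t *\<^sub>R (v' - p)"
      by (simp add: algebra_simps)
    then show ?thesis
      using norm_triangle_ineq[of "(1 - t) *\<^sub>R (v - p)" "t *\<^sub>R (v' - p)"] that by simp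
  qed

  \<comment> \<open>Every loss of distance to \<open>p\<close> between \<open>x n\<close> and \<open>z n\<close> enters \<open>x (Suc n)\<close> with weight
    \<open>\<alpha> n \<ge> a\<close>, so a convergent distance leaves no room for a persistent loss.\<close>
  have z_le: "norm (z n - p) \<le> norm (x n - p)"
    and x_gap: "a * (norm (x n - p) - norm (z n - p)) \<le> norm (x n - p) - norm (x (Suc n) - p)"
    if p: "p \<in> C" "T p = p" for n p
  proof -
    note fix_le = condition_C_fixed_point[OF C(1) p]
    have "\<beta> n * norm (T (x n) - p) \<le> \<beta> n * norm (x n - p)"
      using fix_le[OF xC] \<beta> by (intro mult_left_mono)
    then show z_le: "norm (z n - p) \<le> norm (x n - p)"
      using comb[OF \<beta>, of n "x n" "T (x n)" p] unfolding z by (simp add: algebra_simps)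
    have "norm (x (Suc n) - p) \<le> norm (w n - p)"
      using fix_le[OF TC[OF wC]] fix_le[OF wC] unfolding x_Suc y w_def
      by (meson order_trans)
    also have "\<dots> \<le> (1 - \<alpha> n) * norm (T (x n) - p) + \<alpha> n * norm (T (z n) - p)"
      unfolding w_def by (rule comb) (use \<alpha> in auto)
    also have "\<dots> \<le> (1 - \<alpha> n) * norm (x n - p) + \<alpha> n * norm (z n - p)"
      using fix_le[OF xC] fix_le[OF zC] \<alpha> by (intro add_mono mult_left_mono) auto
    finally have "\<alpha> n * (norm (x n - p) - norm (z n - p)) \<le> norm (x n - p) - norm (x (Suc n) - p)"
      by (simp add: algebra_simps)
    moreover have "a * (norm (x n - p) - norm (z n - p)) \<le> \<alpha> n * (norm (x n - p) - norm (z n - p))"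
      using z_le \<alpha> by (intro mult_right_mono) auto
    ultimately show "a * (norm (x n - p) - norm (z n - p)) \<le> norm (x n - p) - norm (x (Suc n) - p)"
      by linarith
  qed
  have converges: "\<exists>r. (\<lambda>n. norm (x n - p)) \<longlonglongrightarrow> r" if p: "p \<in> C" "T p = p" for p
  proof -
    have "norm (x (Suc n) - p) \<le> norm (x n - p)" for n
    proof -
      have "0 \<le> a * (norm (x n - p) - norm (z n - p))"
        using z_le[OF p, of n] \<open>0 < a\<close> by simp
      with x_gap[OF p, of n] show ?thesis by linarith
    qed
    then have "decseq (\<lambda>n. norm (x n - p))"
      by (rule decseq_SucI)
    then show ?thesis
      using decseq_convergent[of "\<lambda>n. norm (x n - p)" 0] by auto
  qed

  obtain p where p: "p \<in> C" "T p = p"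
    using condition_C_has_fixed_point[OF assms(1,2,3,4) C] by blast
  obtain r where r: "(\<lambda>n. norm (x n - p)) \<longlonglongrightarrow> r"
    using converges[OF p] by blast
  have z_lim: "(\<lambda>n. norm (z n - p)) \<longlonglongrightarrow> r"
  proof (rule tendsto_sandwich)
    have "(\<lambda>n. norm (x n - p) - (norm (x n - p) - norm (x (Suc n) - p)) / a) \<longlonglongrightarrow> r - (r - r) / a"
      using \<open>0 < a\<close> by (intro tendsto_intros r LIMSEQ_Suc[OF r]) simp
    then show "(\<lambda>n. norm (x n - p) - (norm (x n - p) - norm (x (Suc n) - p)) / a) \<longlonglongrightarrow> r"
      by simp
    have "norm (x n - p) - (norm (x n - p) - norm (x (Suc n) - p)) / a \<le> norm (z n - p)" for n
      using x_gap[OF p, of n] \<open>0 < a\<close> by (simp add: field_simps)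
    then show "\<forall>\<^sub>F n in sequentially.
        norm (x n - p) - (norm (x n - p) - norm (x (Suc n) - p)) / a \<le> norm (z n - p)"
      by simp
  qed (use z_le[OF p] r in auto)
  have "(\<lambda>n. (x n - p) - (T (x n) - p)) \<longlonglongrightarrow> 0"
  proof (rule uniformly_convex_combination[OF assms(1) assms(11) \<open>0 < a\<close> \<open>b < 1\<close> _ _ r])
    have "z n - p = (1 - \<beta> n) *\<^sub>R (x n - p) + \<beta> n *\<^sub>R (T (x n) - p)" for n
      unfolding z by (simp add: algebra_simps)
    with z_lim show "(\<lambda>n. norm ((1 - \<beta> n) *\<^sub>R (x n - p) + \<beta> n *\<^sub>R (T (x n) - p))) \<longlonglongrightarrow> r"
      by simp
  qed (use condition_C_fixed_point[OF C(1) p xC] in auto)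
  from tendsto_minus[OF this] have "(\<lambda>n. T (x n) - x n) \<longlonglongrightarrow> 0"
    by simp
  from approximate_fixed_points_subsequence[OF \<open>compact C\<close> C xC this]
  obtain q s where q: "q \<in> C" "T q = q" and s: "strict_mono (s :: nat \<Rightarrow> nat)"
    and xs: "(x \<circ> s) \<longlonglongrightarrow> q" by blast
  \<comment> \<open>The point \<open>q\<close> now takes over the role of \<open>p\<close>: the distances to \<open>q\<close> have a limit too, and the
    subsequence shows that it is zero.\<close>
  obtain r' where r': "(\<lambda>n. norm (x n - q)) \<longlonglongrightarrow> r'"
    using converges[OF q] by blast
  have "(\<lambda>n. norm ((x \<circ> s) n - q)) \<longlonglongrightarrow> norm (q - q)"
    by (intro tendsto_intros xs)
  moreover have "(\<lambda>n. norm ((x \<circ> s) n - q)) \<longlonglongrightarrow> r'"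
    using LIMSEQ_subseq_LIMSEQ[OF r' s] by (simp add: o_def)
  ultimately have "r' = 0"
    using LIMSEQ_unique by fastforce
  with r' have "x \<longlonglongrightarrow> q"
    by (simp add: tendsto_norm_zero_iff LIM_zero_iff)
  with q show ?thesis by blast
qed

end
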